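(* Let $h\ge k\ge0$ be integers, $H=h+1$, $K=k+1$, and let $x_0,\dots,x_k$ be nonnegative real numbers with $x_0+\cdots+x_k=1$ and $x_0>0$. For $\sigma\in\mathcal{S}(H,K)$, the monomial $$\tilde w(\sigma)=\prod_{(s,t)\text{ arch of }\sigma}x_{K-C_\sigma(s,t)}$$ defines an unnormalized stationary measure of the enriched chain, i.e. $\tilde w(\tau)=\sum_{\sigma\in\mathcal{S}(H,K)}\tilde w(\sigma)\tilde P_{\sigma,\tau}$ for all $\tau\in\mathcal{S}(H,K)$.
   Context: $\mathcal{S}(n,m)$ is the set of set partitions of $\{1,\dots,n\}$ into $m$ (nonempty) blocks. For $\sigma\in\mathcal{S}(H,K)$, $\sigma^\downarrow$ is the set partition of $\{1,\dots,h\}$ obtained by removing $1$ from its block in $\sigma$ (and removing this block if it becomes empty), and shifting all remaining elements down by $1$. For $\tau\in\mathcal{S}(h,K)$ and $i\in\{0,\dots,k\}$, $I_i(\tau)\in\mathcal{S}(H,K)$ is obtained by inserting $H$ into the $(i+1)$-th block of $\tau$, where blocks are numbered by ascending order of their maxima. The enriched chain is the Markov chain on $\mathcal{S}(H,K)$ with transition probabilities $$\tilde P_{\sigma,\tau}=\begin{cases}1&\text{if }\{1\}\in\sigma\text{ and }\tau=\sigma^\downarrow\cup\{\{H\}\},\\ x_i&\text{if }\{1\}\notin\sigma\text{ and }\tau=I_i(\sigma^\downarrow)\text{ for some }i\in\{0,\dots,k\},\\0&\text{otherwise.}\end{cases}$$ An arch of $\sigma$ is a pair $(s,t)$ with $1\le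 s<t\le H$ such that $s,t$ belong to the same block of $\sigma$ and no integer strictly between $s$ and $t$ belongs to that block. $C_\sigma(s,t)$ is the number of blocks of $\sigma$ containing at least one element of $\{s,s+1,\dots,t\}$. *)

theory Defs
  imports Complex_Main "HOL-Library.Disjoint_Sets"
begin

definition set_partitions :: "nat \<Rightarrow> nat \<Rightarrow> nat set set set" where
  "set_partitions n m = {\<sigma>. partition_on {1..n} \<sigma> \<and> card \<sigma> = m}"

text \<open>The partition \<open>\<sigma>\<^sup>\<down>\<close>: the point 1 is deleted, the remaining points are shifted down by 1,
  and a block that has become empty is discarded.\<close>

definition drop_first :: "nat set set \<Rightarrow> nat set set" where
  "drop_first \<sigma> = (\<lambda>B. (\<lambda>j. j - 1) ` (B - {1})) ` \<sigma> - {{}}"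

text \<open>Blocks are numbered from 0, in ascending order of their maxima. The maxima of distinct blocks
  are distinct, so the order is strict.\<close>

definition nth_block :: "nat set set \<Rightarrow> nat \<Rightarrow> nat set" where
  "nth_block \<tau> i = sorted_key_list_of_set Max \<tau> ! i"

definition insert_block :: "nat \<Rightarrow> nat \<Rightarrow> nat set set \<Rightarrow> nat set set" where
  "insert_block H i \<tau> = (\<tau> - {nth_block \<tau> i}) \<union> {insert H (nth_block \<tau> i)}"

text \<open>Transition probabilities of the enriched chain on \<open>set_partitions (h + 1) (k + 1)\<close>. For
  \<open>\<sigma>\<close> in this set with \<open>{1} \<notin> \<sigma>\<close>, the partitions \<open>insert_block (h + 1) i (drop_first \<sigma>)\<close> with
  \<open>i \<le> k\<close> are pairwise distinct, so the index \<open>i\<close> below is unique whenever it exists.\<close>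

definition enriched_prob ::
    "nat \<Rightarrow> nat \<Rightarrow> (nat \<Rightarrow> real) \<Rightarrow> nat set set \<Rightarrow> nat set set \<Rightarrow> real" where
  "enriched_prob h k x \<sigma> \<tau> =
    (if {1} \<in> \<sigma> then
       (if \<tau> = drop_first \<sigma> \<union> {{h + 1}} then 1 else 0)
     else if \<exists>i\<le>k. \<tau> = insert_block (h + 1) i (drop_first \<sigma>) then
       x (THE i. i \<le> k \<and> \<tau> = insert_block (h + 1) i (drop_first \<sigma>))
     else 0)"

definition arches :: "nat \<Rightarrow> nat set set \<Rightarrow> (nat \<times> nat) set" where
  "arches H \<sigma> = {(s, t). 1 \<le> s \<and> s < t \<and> t \<le> H \<and>
     (\<exists>B\<in>\<sigma>. s \<in> B \<and> t \<in> B \<and> (\<forall>u. s < u \<and> u < t \<longrightarrow> u \<notin> B))}"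

definition arch_count :: "nat set set \<Rightarrow> nat \<Rightarrow> nat \<Rightarrow> nat" where
  "arch_count \<sigma> s t = card {B \<in> \<sigma>. B \<inter> {s..t} \<noteq> {}}"

text \<open>For \<open>\<sigma>\<close> in \<open>set_partitions H (k + 1)\<close> and an arch \<open>(s, t)\<close> of \<open>\<sigma>\<close>, the count lies between 1
  and \<open>k + 1\<close>, so the subtraction is exact and the index lies in \<open>{0..k}\<close>.\<close>

definition arch_weight :: "nat \<Rightarrow> nat \<Rightarrow> (nat \<Rightarrow> real) \<Rightarrow> nat set set \<Rightarrow> real" where
  "arch_weight h k x \<sigma> = (\<Prod>(s, t)\<in>arches (h + 1) \<sigma>. x (k + 1 - arch_count \<sigma> s t))"

end

theory Submission
  imports Defs
begin

text \<open>Write \<open>H = h + 1\<close>, \<open>K = k + 1\<close>. If \<open>{H}\<close> is a block of \<open>\<tau>\<close>, the only predecessor of \<open>\<tau>\<close> arises by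
  trading \<open>{H}\<close> for a singleton at the other end, which changes neither the arches nor their counts.
  Otherwise \<open>\<tau>\<close> is \<open>\<rho>\<close> with \<open>H\<close> added to block number \<open>i\<close>; the new arch meets the \<open>K - i\<close> blocks
  whose maximum is at least that of block \<open>i\<close>, hence contributes \<open>x i\<close>. The predecessors of \<open>\<tau>\<close> are
  obtained by adding a smallest point to any block of \<open>\<rho>\<close>; if that block has the \<open>j\<close>-th smallest
  minimum, the new arch contributes \<open>x (K - j)\<close>. Summing over \<open>j\<close> gives the total mass 1, times the
  transition probability \<open>x i\<close>.\<close>

section \<open>Arches and weights without reference to the ground set\<close>

definition block_arches :: "nat set \<Rightarrow> (nat \<times> nat) set" where
  "block_arches B = {(s, t). s \<in> B \<and> t \<in> B \<and> s < t \<and> (\<forall>u\<in>B. \<not> (s < u \<and> u < t))}"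

definition arch_set :: "nat set set \<Rightarrow> (nat \<times> nat) set" where
  "arch_set \<sigma> = (\<Union>B\<in>\<sigma>. block_arches B)"

text \<open>The variable is indexed by the count itself; the offset from the number of blocks is
  hidden in \<open>y\<close>. The same \<open>y\<close> can therefore be used for partitions with
  different numbers of blocks, as is needed when a singleton is removed.\<close>

definition weight :: "(nat \<Rightarrow> real) \<Rightarrow> nat set set \<Rightarrow> real" where
  "weight y \<sigma> = (\<Prod>(s, t)\<in>arch_set \<sigma>. y (arch_count \<sigma> s t))"

text \<open>One operation for both ends: with the largest point it is \<open>insert_block\<close>,
  with the point 1 it reverses the deletion in \<open>drop_first\<close>.\<close>

definition extend :: "'a \<Rightarrow> 'a set \<Rightarrow> 'a set set \<Rightarrow> 'a set set" where
  "extend a B \<rho> = insert (insert a B) (\<rho> - {B})"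

text \<open>Reverses the renumbering in \<open>drop_first\<close> and makes room for a new point
  1.\<close>

abbreviation shift :: "nat set set \<Rightarrow> nat set set" where
  "shift \<rho> \<equiv> (`) Suc ` \<rho>"

lemma insert_block_eq_extend: "insert_block H i \<tau> = extend H (nth_block \<tau> i) \<tau>"
  by (auto simp: insert_block_def extend_def)

lemma arches_eq_arch_set:
  assumes "partition_on {1..H} \<sigma>"
  shows "arches H \<sigma> = arch_set \<sigma>"
proof -
  have "1 \<le> s \<and> s \<le> H" if "B \<in> \<sigma>" "s \<in> B" for B s
    using assms that by (auto simp: partition_on_def)
  then show ?thesis
    unfolding arches_def arch_set_def block_arches_def by blast
qed

lemma arch_weight_eq_weight:
  assumes "\<sigma> \<in> set_partitions (h + 1) (k + 1)"
  shows "arch_weight h k x \<sigma> = weight (\<lambda>c. x (k + 1 - c)) \<sigma>"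
  using assms arches_eq_arch_set[of "h + 1" \<sigma>]
  by (simp add: arch_weight_def weight_def set_partitions_def)

subsection \<open>Adding a point to a partition\<close>

text \<open>Look at the block \<open>C\<close> of \<open>a\<close>: either it is \<open>{a}\<close>
  and can be removed, or \<open>C - {a}\<close> is nonempty and takes its place. The rule is applied
  to the largest point of the target and to the smallest point of a predecessor.\<close>

lemma partition_on_insert_cases:
  assumes "partition_on (insert a A) \<sigma>" "a \<notin> A"
  obtains (singleton) \<rho> where "partition_on A \<rho>" "\<sigma> = insert {a} \<rho>"
  | (extend) \<rho> B where "partition_on A \<rho>" "B \<in> \<rho>" "\<sigma> = extend a B \<rho>"
proof -
  obtain C where C: "C \<in> \<sigma>" "a \<in> C"
    using assms by (auto simp: partition_on_def)
  have other: "D \<inter> C = {}" if "D \<in> \<sigma>" "D \<noteq> C" for D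
    using assms that C by (auto simp: partition_on_def disjoint_def)
  have un: "\<Union>\<sigma> = insert a A" and ne: "{} \<notin> \<sigma>"
    and dj: "\<And>D E. D \<in> \<sigma> \<Longrightarrow> E \<in> \<sigma> \<Longrightarrow> D \<noteq> E \<Longrightarrow> D \<inter> E = {}"
    using assms by (auto simp: partition_on_def disjoint_def)
  have rest: "\<Union>(\<sigma> - {C}) = insert a A - C"
    using un other C by blast
  show ?thesis
  proof (cases "C = {a}")
    case True
    have "partition_on A (\<sigma> - {C})"
      using ne dj rest assms(2) True by (auto simp: partition_on_def disjoint_def)
    moreover have "\<sigma> = insert {a} (\<sigma> - {C})"
      using True C by auto
    ultimately show ?thesis by (rule singleton)
  next
    case False
    define B where "B = C - {a}"
    define \<rho> where "\<rho> = insert B (\<sigma> - {C})"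
    have B: "B \<noteq> {}" "insert a B = C" "B \<subseteq> C" "a \<notin> B"
      using False C by (auto simp: B_def)
    \<comment> \<open>A nonempty proper subset of the block \<open>C\<close> cannot be a block as
      well. Hence removing \<open>B\<close> from \<open>\<rho>\<close> leaves exactly
      \<open>\<sigma> - {C}\<close>.\<close>
    have notin: "B \<notin> \<sigma>"
      using B other by blast
    have "partition_on A \<rho>"
      unfolding partition_on_def disjoint_def
    proof (intro conjI ballI impI)
      show "\<Union>\<rho> = A"
        using rest un C B assms(2) by (auto simp: \<rho>_def B_def)
      show "D \<inter> E = {}" if "D \<in> \<rho>" "E \<in> \<rho>" "D \<noteq> E" for D E
        using that dj other B unfolding \<rho>_def by blast
      show "{} \<notin> \<rho>"
        using ne B by (auto simp: \<rho>_def)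
    qed
    moreover have "\<sigma> = extend a B \<rho>"
      using notin B C by (auto simp: extend_def \<rho>_def)
    moreover have "B \<in> \<rho>"
      by (simp add: \<rho>_def)
    ultimately show ?thesis
      by (metis extend)
  qed
qed

context
  fixes A :: "nat set" and \<rho> :: "nat set set" and a :: nat
  assumes fin: "finite A" and part: "partition_on A \<rho>" and notin: "a \<notin> A"
begin

lemma block_facts:
  assumes "B \<in> \<rho>"
  shows "finite B" "B \<noteq> {}" "B \<subseteq> A" "a \<notin> B"
  using assms part notin fin
  by (auto simp: partition_on_def intro: finite_subset[of B A])

lemma blocks_disjoint: "B \<in> \<rho> \<Longrightarrow> C \<in> \<rho> \<Longrightarrow> B \<noteq> C \<Longrightarrow> B \<inter> C = {}"
  using part by (auto simp: partition_on_def disjoint_def)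

lemma finite_blocks: "finite \<rho>"
  using finite_elements[OF fin part] .

text \<open>With \<open>B = {}\<close> this excludes the block \<open>{a}\<close>.\<close>

lemma insert_notin_blocks: "insert a B \<notin> \<rho>"
  using block_facts(4) by blast

lemma partition_on_insert_singleton: "partition_on (insert a A) (insert {a} \<rho>)"
  using part notin by (auto simp: partition_on_def disjoint_def)

lemma partition_on_extend:
  assumes "B \<in> \<rho>"
  shows "partition_on (insert a A) (extend a B \<rho>)"
  unfolding partition_on_def disjoint_def
proof (intro conjI ballI impI)
  show "\<Union>(extend a B \<rho>) = insert a A"
    using assms part by (auto simp: extend_def partition_on_def)
  show "C \<inter> D = {}" if "C \<in> extend a B \<rho>" "D \<in> extend a B \<rho>" "C \<noteq> D" for C D
    using that assms blocks_disjoint block_facts(4) unfolding extend_def by blast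
  show "{} \<notin> extend a B \<rho>"
    using block_facts(2) by (auto simp: extend_def)
qed

lemma card_insert_singleton: "card (insert {a} \<rho>) = Suc (card \<rho>)"
  using finite_blocks insert_notin_blocks[of "{}"] by simp

text \<open>Replacing \<open>B\<close> by \<open>insert a B\<close> is a bijection between the two
  families of blocks. An arbitrary \<open>P\<close> lets arch counts of the extension be computed
  over \<open>\<rho>\<close>.\<close>

lemma card_extend_filter:
  assumes "B \<in> \<rho>"
  shows "card {C \<in> extend a B \<rho>. P C} = card {C \<in> \<rho>. P (if C = B then insert a B else C)}"
proof (rule sym, rule bij_betw_same_card)
  show "bij_betw (\<lambda>C. if C = B then insert a B else C)
    {C \<in> \<rho>. P (if C = B then insert a B else C)} {C \<in> extend a B \<rho>. P C}"
    using assms insert_notin_blocks[of B]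
    by (auto simp: bij_betw_def inj_on_def extend_def image_iff split: if_splits)
qed

lemma card_extend: "B \<in> \<rho> \<Longrightarrow> card (extend a B \<rho>) = card \<rho>"
  using card_extend_filter[of B "\<lambda>_. True"] by simp

lemma singleton_notin_extend: "B \<in> \<rho> \<Longrightarrow> {a} \<notin> extend a B \<rho>"
  using block_facts[of B] insert_notin_blocks[of "{}"] by (auto simp: extend_def)

text \<open>Deleting \<open>a\<close> recovers \<open>\<rho>\<close>. So extensions of different
  partitions differ, and \<open>drop_first\<close> undoes an extension by 1.\<close>

lemma remove_extend: "B \<in> \<rho> \<Longrightarrow> (\<lambda>C. C - {a}) ` extend a B \<rho> = \<rho>"
  using block_facts(4) by (auto simp: extend_def image_iff)

text \<open>In an extension the block containing \<open>a\<close> is unique, and without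
  \<open>a\<close> it is the chosen block.\<close>

lemma extend_inj:
  assumes "B \<in> \<rho>" "C \<in> \<rho>" "extend a B \<rho> = extend a C \<rho>"
  shows "B = C"
proof -
  have "insert a B \<in> extend a C \<rho>"
    using assms(3) by (auto simp: extend_def)
  then have "insert a B = insert a C"
    using insert_notin_blocks[of B] by (auto simp: extend_def)
  then show ?thesis
    using block_facts(4) assms by (metis insert_ident)
qed

lemma inj_on_Max_blocks: "inj_on Max \<rho>"
  by (rule inj_onI) (metis Max_in block_facts(1,2) blocks_disjoint disjoint_iff)

lemma inj_on_Min_blocks: "inj_on Min \<rho>"
  by (rule inj_onI) (metis Min_in block_facts(1,2) blocks_disjoint disjoint_iff)

section \<open>Weight after adding a point below or above all others\<close>

lemma arch_set_subset: "arch_set \<rho> \<subseteq> A \<times> A"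
  using block_facts(3) by (fastforce simp: arch_set_def block_arches_def)

lemma finite_arch_set: "finite (arch_set \<rho>)"
  using finite_subset[OF arch_set_subset] fin by blast

text \<open>A singleton has no arch, and a point below or above all of \<open>A\<close> lies under
  no arch of \<open>\<rho>\<close>, so no count changes.\<close>

lemma weight_insert_singleton:
  assumes "(\<forall>b\<in>A. a < b) \<or> (\<forall>b\<in>A. b < a)"
  shows "weight y (insert {a} \<rho>) = weight y \<rho>"
proof -
  have arches: "arch_set (insert {a} \<rho>) = arch_set \<rho>"
    by (auto simp: arch_set_def block_arches_def)
  have "arch_count (insert {a} \<rho>) s t = arch_count \<rho> s t" if "(s, t) \<in> arch_set \<rho>" for s t
  proof -
    have "a \<notin> {s..t}"
      using arch_set_subset that assms by fastforce
    then have "{B \<in> insert {a} \<rho>. B \<inter> {s..t} \<noteq> {}} = {B \<in> \<rho>. B \<inter> {s..t} \<noteq> {}}"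
      by auto
    then show ?thesis
      by (simp add: arch_count_def)
  qed
  then show ?thesis
    unfolding weight_def arches by (intro prod.cong) auto
qed

text \<open>Common core of the two extreme cases: no old arch spans \<open>a\<close>, so the old
  factors are unchanged, and the single new arch contributes one more factor.\<close>

lemma weight_extend:
  assumes B: "B \<in> \<rho>"
    and outside: "(\<forall>b\<in>A. a < b) \<or> (\<forall>b\<in>A. b < a)"
    and arches: "block_arches (insert a B) = insert (s0, t0) (block_arches B)"
    and new: "s0 = a \<or> t0 = a"
  shows "weight y (extend a B \<rho>) = y (arch_count (extend a B \<rho>) s0 t0) * weight y \<rho>"
proof -
  have set: "arch_set (extend a B \<rho>) = insert (s0, t0) (arch_set \<rho>)"
    using B arches by (auto simp: arch_set_def extend_def)
  \<comment> \<open>One end of the new arch is \<open>a\<close>, which is not in \<open>A\<close>;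
    the product therefore splits off its factor.\<close>
  have fresh: "(s0, t0) \<notin> arch_set \<rho>"
    using arch_set_subset new notin by auto
  have "arch_count (extend a B \<rho>) s t = arch_count \<rho> s t" if "(s, t) \<in> arch_set \<rho>" for s t
  proof -
    have "a \<notin> {s..t}"
      using arch_set_subset that outside by fastforce
    then show ?thesis
      unfolding arch_count_def card_extend_filter[OF B] by (intro arg_cong[where f = card]) auto
  qed
  then have "(\<Prod>(s, t)\<in>arch_set \<rho>. y (arch_count (extend a B \<rho>) s t)) = weight y \<rho>"
    unfolding weight_def by (intro prod.cong) auto
  then show ?thesis
    unfolding weight_def[of y "extend a B \<rho>"] set using fresh finite_arch_set by simp
qed

text \<open>The new arch joins \<open>Max B\<close> to \<open>a\<close>. All old points are below
  \<open>a\<close>, so a block meets this interval exactly when its maximum is at least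
  \<open>Max B\<close>; \<open>B\<close> itself is counted.\<close>

lemma weight_extend_above:
  assumes B: "B \<in> \<rho>" and above: "\<forall>b\<in>A. b < a"
  shows "weight y (extend a B \<rho>) = y (card {C \<in> \<rho>. Max B \<le> Max C}) * weight y \<rho>"
proof -
  have Ba: "b < a" if "b \<in> B" for b
    using that above block_facts(3)[OF B] by auto
  have arches: "block_arches (insert a B) = insert (Max B, a) (block_arches B)"
  proof (intro set_eqI, clarify)
    fix s t
    show "(s, t) \<in> block_arches (insert a B) \<longleftrightarrow> (s, t) \<in> insert (Max B, a) (block_arches B)"
    proof (cases "t = a")
      case True
      have "s = Max B \<longleftrightarrow> s \<in> B \<and> (\<forall>u\<in>B. u \<le> s)"
        using block_facts[OF B] by (metis Max_eq_iff)
      moreover have "(s, t) \<in> block_arches (insert a B) \<longleftrightarrow> s \<in> B \<and> (\<forall>u\<in>B. u \<le> s)"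
        using Ba True by (fastforce simp: block_arches_def not_less)
      moreover have "(s, t) \<notin> block_arches B"
        using block_facts(4)[OF B] True by (simp add: block_arches_def)
      ultimately show ?thesis
        using True by simp
    next
      case False
      then show ?thesis
        using Ba by (fastforce simp: block_arches_def)
    qed
  qed
  have "arch_count (extend a B \<rho>) (Max B) a = card {C \<in> \<rho>. Max B \<le> Max C}"
    unfolding arch_count_def card_extend_filter[OF B]
  proof (rule arg_cong[where f = card], rule Collect_cong, rule conj_cong[OF refl])
    fix C assume C: "C \<in> \<rho>"
    show "((if C = B then insert a B else C) \<inter> {Max B..a} \<noteq> {}) = (Max B \<le> Max C)"
    proof (cases "C = B")
      case True
      then show ?thesis using Ba[of "Max B"] Max_in[of B] block_facts[OF B] by auto
    next
      case False
      have "C \<inter> {Max B..a} \<noteq> {} \<longleftrightarrow> (\<exists>c\<in>C. Max B \<le> c)"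
        using block_facts(3)[OF C] above by fastforce
      also have "\<dots> \<longleftrightarrow> Max B \<le> Max C"
        using Max_ge_iff[of C] block_facts[OF C] by blast
      finally show ?thesis using False by simp
    qed
  qed
  then show ?thesis
    using weight_extend[OF B _ arches] above by simp
qed

text \<open>Mirror image of the case above: the new arch joins \<open>a\<close> to
  \<open>Min B\<close>, and minima replace maxima.\<close>

lemma weight_extend_below:
  assumes B: "B \<in> \<rho>" and below: "\<forall>b\<in>A. a < b"
  shows "weight y (extend a B \<rho>) = y (card {C \<in> \<rho>. Min C \<le> Min B}) * weight y \<rho>"
proof -
  have Ba: "a < b" if "b \<in> B" for b
    using that below block_facts(3)[OF B] by auto
  have arches: "block_arches (insert a B) = insert (a, Min B) (block_arches B)"
  proof (intro set_eqI, clarify)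
    fix s t
    show "(s, t) \<in> block_arches (insert a B) \<longleftrightarrow> (s, t) \<in> insert (a, Min B) (block_arches B)"
    proof (cases "s = a")
      case True
      have "t = Min B \<longleftrightarrow> t \<in> B \<and> (\<forall>u\<in>B. t \<le> u)"
        using block_facts[OF B] by (metis Min_eq_iff)
      moreover have "(s, t) \<in> block_arches (insert a B) \<longleftrightarrow> t \<in> B \<and> (\<forall>u\<in>B. t \<le> u)"
        using Ba True by (fastforce simp: block_arches_def not_less)
      moreover have "(s, t) \<notin> block_arches B"
        using block_facts(4)[OF B] True by (simp add: block_arches_def)
      ultimately show ?thesis
        using True by simp
    next
      case False
      then show ?thesis
        using Ba by (fastforce simp: block_arches_def)
    qed
  qed
  have "arch_count (extend a B \<rho>) a (Min B) = card {C \<in> \<rho>. Min C \<le> Min B}"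
    unfolding arch_count_def card_extend_filter[OF B]
  proof (rule arg_cong[where f = card], rule Collect_cong, rule conj_cong[OF refl])
    fix C assume C: "C \<in> \<rho>"
    show "((if C = B then insert a B else C) \<inter> {a..Min B} \<noteq> {}) = (Min C \<le> Min B)"
    proof (cases "C = B")
      case True
      then show ?thesis using Ba[of "Min B"] Min_in[of B] block_facts[OF B] by auto
    next
      case False
      have "C \<inter> {a..Min B} \<noteq> {} \<longleftrightarrow> (\<exists>c\<in>C. c \<le> Min B)"
        using block_facts(3)[OF C] below by fastforce
      also have "\<dots> \<longleftrightarrow> Min C \<le> Min B"
        using Min_le_iff[of C] block_facts[OF C] by blast
      finally show ?thesis using False by simp
    qed
  qed
  then show ?thesis
    using weight_extend[OF B _ arches] below by simp
qed

end

subsection \<open>Ranks of blocks\<close>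

text \<open>The rank is strictly monotone in \<open>g\<close>, hence injective, and at least 1
  because each element counts itself. An injection into a finite set of the same size is
  onto.\<close>

lemma bij_betw_rank:
  fixes g :: "'a \<Rightarrow> 'b::linorder"
  assumes "finite A" "inj_on g A"
  shows "bij_betw (\<lambda>b. card {c \<in> A. g c \<le> g b}) A {1..card A}"
proof -
  have less: "card {c \<in> A. g c \<le> g a} < card {c \<in> A. g c \<le> g b}"
    if "a \<in> A" "b \<in> A" "g a < g b" for a b
  proof (rule psubset_card_mono)
    have "b \<in> {c \<in> A. g c \<le> g b}" "b \<notin> {c \<in> A. g c \<le> g a}"
      using that by auto
    then show "{c \<in> A. g c \<le> g a} \<subset> {c \<in> A. g c \<le> g b}"
      using that(3) by fastforce
  qed (use assms(1) in simp)
  have inj: "inj_on (\<lambda>b. card {c \<in> A. g c \<le> g b}) A"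
  proof (rule inj_onI)
    fix a b
    assume "a \<in> A" "b \<in> A" "card {c \<in> A. g c \<le> g a} = card {c \<in> A. g c \<le> g b}"
    then have "g a = g b"
      using less[of a b] less[of b a] by (cases "g a" "g b" rule: linorder_cases) auto
    then show "a = b"
      using \<open>a \<in> A\<close> \<open>b \<in> A\<close> assms(2) by (simp add: inj_on_eq_iff)
  qed
  moreover have "(\<lambda>b. card {c \<in> A. g c \<le> g b}) ` A \<subseteq> {1..card A}"
    using assms(1) by (auto simp: Suc_le_eq card_gt_0_iff intro!: card_mono)
  ultimately show ?thesis
    by (simp add: bij_betw_def card_image card_subset_eq)
qed

text \<open>Instances of the locale \<open>folding_insort_key\<close> speak about the \<open>linorder\<close> locale constant
  instead of the type class constant.\<close>

lemma linorder_sorted_key_list_of_set: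
  "linorder.sorted_key_list_of_set ((\<le>) :: 'a::linorder \<Rightarrow> _) = sorted_key_list_of_set"
proof (rule ext)
  fix f :: "'b \<Rightarrow> 'a"
  have "linorder.insort_key (\<le>) f b xs = insort_key f b xs" for b xs
    by (induction xs) (simp_all add: linorder.insort_key.simps[OF linorder_axioms])
  then have "linorder.insort_key (\<le>) f = insort_key f"
    by (intro ext)
  then show "linorder.sorted_key_list_of_set (\<le>) f = sorted_key_list_of_set f"
    by (simp add: linorder_class.sorted_key_list_of_set_def
        linorder.sorted_key_list_of_set_def[OF linorder_axioms])
qed

context
  fixes h :: nat and \<rho> :: "nat set set"
  assumes part: "partition_on {1..h} \<rho>"
begin

lemma sorted_blocks:
  shows "set (sorted_key_list_of_set Max \<rho>) = \<rho>"
    and "distinct (sorted_key_list_of_set Max \<rho>)"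
    and "length (sorted_key_list_of_set Max \<rho>) = card \<rho>"
    and "sorted_wrt (\<lambda>B C. Max B < Max C) (sorted_key_list_of_set Max \<rho>)"
proof -
  \<comment> \<open>The borrowed lemma wants a point outside the ground set; 0 is an arbitrary
    choice.\<close>
  have inj: "inj_on Max \<rho>" and fin: "finite \<rho>"
    using inj_on_Max_blocks[OF _ part, of 0] finite_elements[OF _ part] by auto
  \<comment> \<open>The key is injective only on \<open>\<rho>\<close>, so \<open>\<rho>\<close> is
    also the ambient set; this explains \<open>subset_refl\<close> below.\<close>
  interpret folding_insort_key "(\<le>)" "(<)" \<rho> Max
    by unfold_locales (rule inj)
  note facts = set_sorted_key_list_of_set[OF subset_refl fin]
    length_sorted_key_list_of_set[OF subset_refl]
    distinct_if_distinct_map[OF distinct_sorted_key_list_of_set[OF subset_refl]]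
    strict_sorted_key_list_of_set[OF subset_refl]
  note facts = facts[unfolded linorder_sorted_key_list_of_set]
  show "set (sorted_key_list_of_set Max \<rho>) = \<rho>"
    by (rule facts(1))
  show "length (sorted_key_list_of_set Max \<rho>) = card \<rho>"
    by (rule facts(2))
  show "distinct (sorted_key_list_of_set Max \<rho>)"
    by (rule facts(3))
  show "sorted_wrt (\<lambda>B C. Max B < Max C) (sorted_key_list_of_set Max \<rho>)"
    using facts(4) by (simp add: sorted_wrt_map)
qed

lemma nth_block_in: "i < card \<rho> \<Longrightarrow> nth_block \<rho> i \<in> \<rho>"
  unfolding nth_block_def using sorted_blocks(1,3) nth_mem by metis

lemma nth_block_surj: "B \<in> \<rho> \<Longrightarrow> \<exists>i<card \<rho>. nth_block \<rho> i = B"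
  unfolding nth_block_def using sorted_blocks(1,3) by (metis in_set_conv_nth)

lemma nth_block_inj:
  "i < card \<rho> \<Longrightarrow> j < card \<rho> \<Longrightarrow> nth_block \<rho> i = nth_block \<rho> j \<Longrightarrow> i = j"
  unfolding nth_block_def using sorted_blocks(2,3) by (simp add: nth_eq_iff_index_eq)

text \<open>These are the blocks numbered from \<open>i\<close> to \<open>card \<rho> - 1\<close>.
  The count is the one belonging to the arch created by inserting the largest point into block
  \<open>i\<close>.\<close>

lemma card_Max_ge_nth_block:
  assumes i: "i < card \<rho>"
  shows "card {C \<in> \<rho>. Max (nth_block \<rho> i) \<le> Max C} = card \<rho> - i"
proof -
  have mono: "Max (nth_block \<rho> j) < Max (nth_block \<rho> l)" if "j < l" "l < card \<rho>" for j l
    using sorted_blocks(3,4) that by (auto simp: nth_block_def sorted_wrt_iff_nth_less)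
  have iff: "Max (nth_block \<rho> i) \<le> Max (nth_block \<rho> j) \<longleftrightarrow> i \<le> j" if "j < card \<rho>" for j
    using mono[of i j] mono[of j i] that i by (cases i j rule: linorder_cases) auto
  have "{C \<in> \<rho>. Max (nth_block \<rho> i) \<le> Max C} = nth_block \<rho> ` {i..<card \<rho>}"
    using nth_block_surj nth_block_in iff by fastforce
  moreover have "inj_on (nth_block \<rho>) {i..<card \<rho>}"
    by (auto intro!: inj_onI nth_block_inj)
  ultimately show ?thesis
    by (simp add: card_image)
qed

end

subsection \<open>Shifting a partition\<close>

lemma inj_image_Suc: "inj ((`) Suc)"
  by (simp add: inj_image_eq_iff inj_def)

lemma arch_count_shift: "arch_count (shift \<rho>) (Suc s) (Suc t) = arch_count \<rho> s t"
proof -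
  have "{B \<in> shift \<rho>. B \<inter> {Suc s..Suc t} \<noteq> {}} =
      shift {B \<in> \<rho>. Suc ` B \<inter> {Suc s..Suc t} \<noteq> {}}"
    by (auto simp only: image_iff mem_Collect_eq)
  moreover have "Suc ` B \<inter> {Suc s..Suc t} \<noteq> {} \<longleftrightarrow> B \<inter> {s..t} \<noteq> {}" for B
    by auto
  ultimately show ?thesis
    by (simp add: arch_count_def card_image inj_on_subset[OF inj_image_Suc])
qed

lemma arch_set_shift: "arch_set (shift \<rho>) = map_prod Suc Suc ` arch_set \<rho>"
proof -
  have "block_arches (Suc ` B) = map_prod Suc Suc ` block_arches B" for B
    by (auto simp: block_arches_def image_iff)
  then show ?thesis
    by (simp add: arch_set_def image_UN)
qed

lemma weight_shift: "weight y (shift \<rho>) = weight y \<rho>"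
proof -
  have "inj_on (map_prod Suc Suc) (arch_set \<rho>)"
    by (auto simp: inj_on_def)
  then show ?thesis
    by (simp add: weight_def arch_set_shift prod.reindex case_prod_unfold arch_count_shift)
qed

lemma card_shift: "card (shift \<rho>) = card \<rho>"
  by (simp add: card_image inj_on_subset[OF inj_image_Suc])

lemma partition_on_shift:
  assumes "partition_on {1..h} \<rho>"
  shows "partition_on {2..Suc h} (shift \<rho>)"
proof -
  have "partition_on (Suc ` {1..h}) (shift \<rho> - {{}})"
    using assms by (intro partition_on_inj_image) auto
  moreover have "{} \<notin> shift \<rho>"
    using assms by (auto simp: partition_on_def)
  ultimately show ?thesis
    by (simp add: numeral_2_eq_2 del: image_Suc_atLeastAtMost flip: image_Suc_atLeastAtMost)
qed

lemma partition_on_shiftE: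
  assumes "partition_on {2..Suc h} \<rho>'"
  obtains \<rho> where "partition_on {1..h} \<rho>" "\<rho>' = shift \<rho>"
proof -
  define \<rho> where "\<rho> = (`) (\<lambda>j. j - 1) ` \<rho>'"
  have img: "(\<lambda>j. j - 1) ` {2..Suc h} = {1..h}"
    by (force simp: image_iff intro: bexI[of _ "Suc _"])
  have "{} \<notin> \<rho>"
    using assms by (auto simp: \<rho>_def partition_on_def)
  moreover have "inj_on (\<lambda>j. j - 1) {2..Suc h}"
    by (auto simp: inj_on_def)
  ultimately have part: "partition_on {1..h} \<rho>"
    using partition_on_inj_image[OF assms, of "\<lambda>j. j - 1", unfolded img, folded \<rho>_def] by simp
  \<comment> \<open>All points are at least 2, so the truncated subtraction is exact and
    \<open>Suc\<close> undoes it.\<close>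
  have "(\<lambda>j. Suc (j - 1)) ` B = B" if "B \<in> \<rho>'" for B
  proof -
    have "B \<subseteq> {2..Suc h}"
      using that assms by (auto simp: partition_on_def)
    then have "Suc (j - 1) = j" if "j \<in> B" for j
      using that by force
    then show ?thesis
      by simp
  qed
  then have "\<rho>' = shift \<rho>"
    by (simp add: \<rho>_def image_image)
  with part show thesis
    by (rule that)
qed

lemma drop_first_insert_singleton:
  assumes "partition_on {1..h} \<rho>"
  shows "drop_first (insert {1} (shift \<rho>)) = \<rho>"
proof -
  have "(\<lambda>j. j - 1) ` (Suc ` C - {1}) = C" if "C \<in> \<rho>" for C
  proof -
    have "0 \<notin> C"
      using that assms by (force simp: partition_on_def)
    then have "Suc ` C - {1} = Suc ` C"
      by auto
    then show ?thesis
      by (simp add: image_image)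
  qed
  then have "(\<lambda>B. (\<lambda>j. j - 1) ` (B - {1})) ` shift \<rho> = \<rho>"
    by (simp add: image_image)
  moreover have "{} \<notin> \<rho>"
    using assms by (simp add: partition_on_def)
  ultimately show ?thesis
    by (simp add: drop_first_def)
qed

text \<open>Split \<open>drop_first\<close> into deletion of 1, which \<open>remove_extend\<close>
  handles, and the renumbering, which cancels against \<open>shift\<close>.\<close>

lemma drop_first_extend:
  assumes "partition_on {1..h} \<rho>" "B \<in> shift \<rho>"
  shows "drop_first (extend 1 B (shift \<rho>)) = \<rho>"
proof -
  have "drop_first (extend 1 B (shift \<rho>)) =
    (\<lambda>C. (\<lambda>j. j - 1) ` C) ` (\<lambda>C. C - {1}) ` extend 1 B (shift \<rho>) - {{}}"
    by (simp add: drop_first_def image_image)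
  also have "(\<lambda>C. C - {1}) ` extend 1 B (shift \<rho>) = shift \<rho>"
    using assms(2) by (intro remove_extend[OF _ partition_on_shift[OF assms(1)]]) auto
  also have "(\<lambda>C. (\<lambda>j. j - 1) ` C) ` shift \<rho> = \<rho>"
    by (simp add: image_image)
  finally show ?thesis
    using assms(1) by (simp add: partition_on_def)
qed

subsection \<open>The enriched chain\<close>

lemma finite_set_partitions: "finite (set_partitions n m)"
  by (rule finite_subset[OF _ finitely_many_partition_on[of "{1..n}"]])
    (auto simp: set_partitions_def)

lemma set_partitions_cases_above:
  assumes "\<tau> \<in> set_partitions (Suc h) (Suc k)"
  obtains (singleton) \<rho> where "partition_on {1..h} \<rho>" "\<tau> = insert {Suc h} \<rho>"
  | (extend) \<rho> B where "partition_on {1..h} \<rho>" "card \<rho> = Suc k" "B \<in> \<rho>"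
    "\<tau> = extend (Suc h) B \<rho>"
proof -
  have part: "partition_on (insert (Suc h) {1..h}) \<tau>" and card: "card \<tau> = Suc k"
    using assms by (simp_all add: set_partitions_def atLeastAtMostSuc_conv)
  have "Suc h \<notin> {1..h}"
    by simp
  with part show thesis
  proof (cases rule: partition_on_insert_cases)
    case (extend \<rho> B)
    then have "card \<rho> = Suc k"
      using card card_extend[OF _ extend(1), of "Suc h" B] by simp
    then show ?thesis
      using extend that(2) by blast
  qed (use that(1) in auto)
qed

text \<open>The part left after removing 1 is written as a shift, so that predecessors and targets
  are both described by partitions of \<open>{1..h}\<close>.\<close>

lemma set_partitions_cases_below:
  assumes "\<sigma> \<in> set_partitions (Suc h) (Suc k)"
  obtains (singleton) \<rho> where "partition_on {1..h} \<rho>" "\<sigma> = insert {1} (shift \<rho>)"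
  | (extend) \<rho> B where "partition_on {1..h} \<rho>" "card \<rho> = Suc k" "B \<in> shift \<rho>"
    "\<sigma> = extend 1 B (shift \<rho>)"
proof -
  have "{1..Suc h} = insert 1 {2..Suc h}"
    by auto
  then have part: "partition_on (insert 1 {2..Suc h}) \<sigma>" and card: "card \<sigma> = Suc k"
    using assms by (simp_all add: set_partitions_def)
  have "1 \<notin> {2..Suc h}"
    by simp
  with part show thesis
  proof (cases rule: partition_on_insert_cases)
    case (singleton \<rho>')
    then show ?thesis
      by (metis partition_on_shiftE that(1))
  next
    case (extend \<rho>' B)
    obtain \<rho> where \<rho>: "partition_on {1..h} \<rho>" "\<rho>' = shift \<rho>"
      using partition_on_shiftE extend(1) .
    moreover have "card \<rho> = Suc k"
      using card card_extend[OF _ extend(1), of 1 B] extend \<rho> card_shift by simp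
    ultimately show ?thesis
      using that(2) extend by blast
  qed
qed

section \<open>Transition probabilities in terms of partitions of \<open>{1..h}\<close>\<close>

lemma enriched_prob_singleton:
  assumes "partition_on {1..h} \<rho>"
  shows "enriched_prob h k x (insert {1} (shift \<rho>)) \<tau> = (if \<tau> = insert {Suc h} \<rho> then 1 else 0)"
  using drop_first_insert_singleton[OF assms] by (simp add: enriched_prob_def)

context
  fixes h k :: nat and \<rho> :: "nat set set" and B :: "nat set" and x :: "nat \<Rightarrow> real"
  assumes part: "partition_on {1..h} \<rho>" and card: "card \<rho> = Suc k" and B: "B \<in> shift \<rho>"
begin

lemma enriched_prob_extend:
  "enriched_prob h k x (extend 1 B (shift \<rho>)) \<tau> =
    (if \<exists>i\<le>k. \<tau> = extend (Suc h) (nth_block \<rho> i) \<rho>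
     then x (THE i. i \<le> k \<and> \<tau> = extend (Suc h) (nth_block \<rho> i) \<rho>) else 0)"
  using drop_first_extend[OF part B]
    singleton_notin_extend[OF _ partition_on_shift[OF part], of 1 B] B
  unfolding enriched_prob_def insert_block_eq_extend Suc_eq_plus1 by auto

text \<open>From such a state the new largest point joins a nonempty block, so it never forms a
  singleton.\<close>

lemma enriched_prob_extend_singleton:
  "enriched_prob h k x (extend 1 B (shift \<rho>)) (insert {Suc h} \<rho>') = 0"
proof -
  have "insert {Suc h} \<rho>' \<noteq> extend (Suc h) (nth_block \<rho> i) \<rho>" if "i \<le> k" for i
    using singleton_notin_extend[OF _ part, of "Suc h" "nth_block \<rho> i"] nth_block_in[OF part, of i]
      that card by auto
  then show ?thesis
    unfolding enriched_prob_extend by auto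
qed

text \<open>Deleting the largest point from a reachable target gives back \<open>\<rho>\<close>,
  which rules out targets built from \<open>\<rho>'\<close>.\<close>

lemma enriched_prob_extend_other:
  assumes "partition_on {1..h} \<rho>'" "B' \<in> \<rho>'" "\<rho>' \<noteq> \<rho>"
  shows "enriched_prob h k x (extend 1 B (shift \<rho>)) (extend (Suc h) B' \<rho>') = 0"
proof -
  have "extend (Suc h) B' \<rho>' \<noteq> extend (Suc h) (nth_block \<rho> i) \<rho>" if "i \<le> k" for i
    using remove_extend[OF _ part, of "Suc h" "nth_block \<rho> i"] nth_block_in[OF part, of i]
      remove_extend[OF _ assms(1), of "Suc h" B'] that card assms(2,3) by auto
  then show ?thesis
    unfolding enriched_prob_extend by auto
qed

text \<open>The target determines the enlarged block by \<open>extend_inj\<close>, and the block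
  determines its number by \<open>nth_block_inj\<close>; so the definite description evaluates to
  \<open>i\<close>.\<close>

lemma enriched_prob_extend_same:
  assumes "i \<le> k"
  shows "enriched_prob h k x (extend 1 B (shift \<rho>)) (extend (Suc h) (nth_block \<rho> i) \<rho>) = x i"
proof -
  let ?P = "\<lambda>j. j \<le> k \<and> extend (Suc h) (nth_block \<rho> i) \<rho> = extend (Suc h) (nth_block \<rho> j) \<rho>"
  have P: "?P i"
    using assms by simp
  have "j = i" if "?P j" for j
    using that assms card nth_block_in[OF part] nth_block_inj[OF part, of j i]
      extend_inj[OF _ part, of "Suc h" "nth_block \<rho> i" "nth_block \<rho> j"] by auto
  with P have the: "(THE j. ?P j) = i"
    by (rule the_equality)
  from P have "\<exists>j. ?P j"
    by (rule exI)
  then show ?thesis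
    unfolding enriched_prob_extend the by (rule if_P)
qed

end

section \<open>Summation over the predecessors of a state\<close>

theorem lemma2p25:
  fixes h k :: nat and x :: "nat \<Rightarrow> real"
  assumes "k \<le> h"
    and "\<And>i. i \<le> k \<Longrightarrow> 0 \<le> x i"
    and "(\<Sum>i\<le>k. x i) = 1"
    and "0 < x 0"
  shows "\<forall>\<tau>\<in>set_partitions (h + 1) (k + 1).
    arch_weight h k x \<tau> =
      (\<Sum>\<sigma>\<in>set_partitions (h + 1) (k + 1). arch_weight h k x \<sigma> * enriched_prob h k x \<sigma> \<tau>)"
proof
  fix \<tau> assume \<tau>: "\<tau> \<in> set_partitions (h + 1) (k + 1)"
  define y where "y = (\<lambda>c. x (k + 1 - c))"
  define S where "S = set_partitions (Suc h) (Suc k)"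
  have finS: "finite S"
    by (simp add: S_def finite_set_partitions)
  have weight: "arch_weight h k x \<sigma> = weight y \<sigma>" if "\<sigma> \<in> S" for \<sigma>
    using that arch_weight_eq_weight by (simp add: y_def S_def)
  have "{1..Suc h} = insert 1 {2..Suc h}"
    by auto
  then have S_iff: "\<sigma> \<in> S \<longleftrightarrow> partition_on (insert 1 {2..Suc h}) \<sigma> \<and> card \<sigma> = Suc k" for \<sigma>
    by (simp only: S_def set_partitions_def mem_Collect_eq)
  have "weight y \<tau> = (\<Sum>\<sigma>\<in>S. weight y \<sigma> * enriched_prob h k x \<sigma> \<tau>)"
    using \<tau>[unfolded Suc_eq_plus1[symmetric]]
  proof (cases rule: set_partitions_cases_above)
    case (singleton \<rho>)
    define \<sigma>0 where "\<sigma>0 = insert {1} (shift \<rho>)"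
    have part: "partition_on {2..Suc h} (shift \<rho>)"
      using singleton by (intro partition_on_shift)
    \<comment> \<open>Since \<open>{Suc h}\<close> accounts for one of the \<open>k + 1\<close>
      blocks of \<open>\<tau>\<close>, adding \<open>{1}\<close> to the shifted rest restores the
      right number of blocks.\<close>
    have "card \<rho> = k"
      using card_insert_singleton[OF _ singleton(1), of "Suc h"] singleton(2) \<tau>
      by (simp add: set_partitions_def)
    then have "\<sigma>0 \<in> S"
      using partition_on_insert_singleton[OF _ part, of 1] card_insert_singleton[OF _ part, of 1]
      by (simp add: S_iff \<sigma>0_def card_shift)
    have "weight y \<sigma>0 = weight y \<tau>"
      using weight_insert_singleton[OF _ part, of 1] singleton
        weight_insert_singleton[OF _ singleton(1), of "Suc h"]
      by (simp add: \<sigma>0_def weight_shift)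
    \<comment> \<open>Among states containing \<open>{1}\<close>, the target determines the state;
      states without \<open>{1}\<close> cannot produce the block \<open>{Suc h}\<close>.\<close>
    moreover have "enriched_prob h k x \<sigma> \<tau> = (if \<sigma> = \<sigma>0 then 1 else 0)" if "\<sigma> \<in> S" for \<sigma>
      using that[unfolded S_def]
    proof (cases rule: set_partitions_cases_below)
      case (singleton \<rho>')
      have "\<rho>' = \<rho>" if "\<tau> = insert {Suc h} \<rho>'"
        using that \<open>\<tau> = insert {Suc h} \<rho>\<close> insert_notin_blocks[OF _ singleton(1), of "Suc h" "{}"]
          insert_notin_blocks[OF _ \<open>partition_on {1..h} \<rho>\<close>, of "Suc h" "{}"]
        by (simp add: insert_ident)
      moreover have "\<rho>' = \<rho>" if "\<sigma> = \<sigma>0"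
        using that singleton(2) drop_first_insert_singleton[OF singleton(1)]
          drop_first_insert_singleton[OF \<open>partition_on {1..h} \<rho>\<close>] by (simp add: \<sigma>0_def)
      ultimately have "\<tau> = insert {Suc h} \<rho>' \<longleftrightarrow> \<sigma> = \<sigma>0"
        unfolding \<sigma>0_def singleton(2) \<open>\<tau> = insert {Suc h} \<rho>\<close> by (intro iffI; simp)
      then show ?thesis
        using enriched_prob_singleton[OF singleton(1), of k x \<tau>] singleton(2) by simp
    next
      case (extend \<rho>' B)
      have "{1} \<notin> \<sigma>"
        using extend singleton_notin_extend[OF _ partition_on_shift[OF extend(1)], of 1 B] by simp
      then have "\<sigma> \<noteq> \<sigma>0"
        by (auto simp: \<sigma>0_def)
      then show ?thesis
        using enriched_prob_extend_singleton[OF extend(1-3)] extend(4) \<open>\<tau> = insert {Suc h} \<rho>\<close>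
        by simp
    qed
    then have "(\<Sum>\<sigma>\<in>S. weight y \<sigma> * enriched_prob h k x \<sigma> \<tau>) =
        (\<Sum>\<sigma>\<in>S. if \<sigma> = \<sigma>0 then weight y \<sigma> else 0)"
      by (intro sum.cong) auto
    ultimately show ?thesis
      using finS \<open>\<sigma>0 \<in> S\<close> by simp
  next
    case (extend \<rho> B)
    obtain i where i: "i \<le> k" "nth_block \<rho> i = B"
      using nth_block_surj[OF extend(1,3)] extend(2) less_Suc_eq_le by metis
    have part: "partition_on {2..Suc h} (shift \<rho>)"
      using extend(1) by (rule partition_on_shift)
    define \<phi> where "\<phi> = (\<lambda>C. extend 1 C (shift \<rho>))"
    have sub: "\<phi> ` shift \<rho> \<subseteq> S"
      using partition_on_extend[OF _ part, of 1] card_extend[OF _ part, of 1] extend(2)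
      by (auto simp: S_iff \<phi>_def card_shift)
    \<comment> \<open>A state outside the image either contains \<open>{1}\<close>, and then moves
      to a partition with block \<open>{Suc h}\<close>, or extends a partition other than
      \<open>\<rho>\<close>.\<close>
    have zero: "enriched_prob h k x \<sigma> \<tau> = 0" if "\<sigma> \<in> S - \<phi> ` shift \<rho>" for \<sigma>
      using that[unfolded S_def, THEN DiffD1]
    proof (cases rule: set_partitions_cases_below)
      case (singleton \<rho>')
      have "\<tau> \<noteq> insert {Suc h} \<rho>'"
        using singleton_notin_extend[OF _ extend(1), of "Suc h" B] extend by auto
      then show ?thesis
        using enriched_prob_singleton[OF singleton(1)] singleton(2) by simp
    next
      case (extend \<rho>' B')
      then have "\<rho> \<noteq> \<rho>'"
        using that by (auto simp: \<phi>_def)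
      then show ?thesis
        using enriched_prob_extend_other[OF extend(1-3)] extend(4)
          \<open>partition_on {1..h} \<rho>\<close> \<open>B \<in> \<rho>\<close> \<open>\<tau> = extend (Suc h) B \<rho>\<close> by simp
    qed
    have inj: "inj_on \<phi> (shift \<rho>)"
      unfolding \<phi>_def
      by (intro inj_onI, rule extend_inj[OF finite_atLeastAtMost part, of 1]) (simp, assumption+)
    \<comment> \<open>Here blocks are ordered by minima, because 1 is added from below, while
      \<open>nth_block\<close> orders by maxima. The two orders need not agree: the sum uses only
      that \<open>rank\<close> is a bijection.\<close>
    define rank where "rank = (\<lambda>C. card {D \<in> shift \<rho>. Min D \<le> Min C})"
    have rank: "bij_betw rank (shift \<rho>) {1..Suc k}"
      unfolding rank_def using bij_betw_rank[of "shift \<rho>" Min] inj_on_Min_blocks[OF _ part, of 1]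
        finite_blocks[OF _ part, of 1] extend(2) by (simp add: card_shift)
    have "(\<Sum>\<sigma>\<in>S. weight y \<sigma> * enriched_prob h k x \<sigma> \<tau>) =
        (\<Sum>\<sigma>\<in>\<phi> ` shift \<rho>. weight y \<sigma> * enriched_prob h k x \<sigma> \<tau>)"
      using finS sub zero by (intro sum.mono_neutral_right) auto
    also have "\<dots> = (\<Sum>C\<in>shift \<rho>. weight y (\<phi> C) * enriched_prob h k x (\<phi> C) \<tau>)"
      using inj by (simp add: sum.reindex)
    also have "\<dots> = (\<Sum>C\<in>shift \<rho>. y (rank C) * (weight y \<rho> * x i))"
    proof (rule sum.cong[OF refl])
      fix C assume C: "C \<in> shift \<rho>"
      have "weight y (\<phi> C) = y (rank C) * weight y \<rho>"
        using weight_extend_below[OF _ part _ C, of 1] by (simp add: \<phi>_def rank_def weight_shift)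
      moreover have "enriched_prob h k x (\<phi> C) \<tau> = x i"
        using enriched_prob_extend_same[OF extend(1,2) C i(1)] i extend(4) by (simp add: \<phi>_def)
      ultimately show "weight y (\<phi> C) * enriched_prob h k x (\<phi> C) \<tau> = y (rank C) * (weight y \<rho> * x i)"
        by simp
    qed
    also have "\<dots> = (\<Sum>C\<in>shift \<rho>. y (rank C)) * (weight y \<rho> * x i)"
      by (rule sum_distrib_right[symmetric])
    also have "(\<Sum>C\<in>shift \<rho>. y (rank C)) = (\<Sum>j=1..Suc k. y j)"
      using rank by (rule sum.reindex_bij_betw)
    \<comment> \<open>As \<open>y j\<close> is \<open>x (k + 1 - j)\<close>, reversing the order
      turns the ranks 1 to \<open>k + 1\<close> into the indices \<open>k\<close> down to 0, each
      hit once.\<close>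
    also have "\<dots> = (\<Sum>j\<le>k. x j)"
      by (rule sum.reindex_bij_witness[of _ "\<lambda>j. Suc k - j" "\<lambda>j. Suc k - j"])
        (auto simp: y_def)
    also have "\<dots> * (weight y \<rho> * x i) = x i * weight y \<rho>"
      using assms(3) by simp
    \<comment> \<open>The arch at the largest point has count \<open>k + 1 - i\<close>, and
      \<open>y\<close> turns this back into \<open>x i\<close>, the factor supplied above by the
      transition probability.\<close>
    also have "\<dots> = weight y \<tau>"
      using weight_extend_above[OF _ extend(1) _ extend(3), of "Suc h" y] extend(2,4) i
        card_Max_ge_nth_block[OF extend(1), of i] by (simp add: y_def)
    finally show ?thesis
      by (rule sym)
  qed
  then show "arch_weight h k x \<tau> = (\<Sum>\<sigma>\<in>set_partitions (h + 1) (k + 1).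
      arch_weight h k x \<sigma> * enriched_prob h k x \<sigma> \<tau>)"
    using weight \<tau> by (simp add: S_def)
qed

end
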